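(* If $A$ is a generalized quaternion algebra over a field $F$ of characteristic $0$, then $\mathrm{M}_n(A) = Z(\mathrm{M}_n(A)) + [\mathrm{M}_n(A), \mathrm{M}_n(A)]$ for all positive integers $n$.
   Context: A generalized quaternion algebra over a field $F$ is an associative unital $F$-algebra containing $F$ that is a $4$-dimensional vector space over $F$ with basis $\{1,i,j,k\}$, whose multiplication satisfies: (i) if $\operatorname{char}(F)\neq 2$, then $i^2,j^2\in F\setminus\{0\}$ and $k=ij=-ji$; (ii) if $\operatorname{char}(F)=2$, then $i^2+i\in F$, $j^2\in F\setminus\{0\}$ and $k=ij=j(i+1)$. $\mathrm{M}_n(A)$ denotes the algebra of $n\times n$ matrices over $A$. For a unital associative algebra $B$, $Z(B)$ is its center and $[B,B]$ is the additive subgroup of $B$ generated by all additive commutators $ab-ba$ with $a,b\in B$. *)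

theory Defs
  imports
    "HOL-Algebra.Algebra"
    "Jordan_Normal_Form.Matrix"
begin

section \<open>Generalized quaternion algebras\<close>

locale unital_algebra = vector_space scale
  for scale :: "'f::field \<Rightarrow> 'a::ring_1 \<Rightarrow> 'a" +
  assumes scale_mult_left: "scale c x * y = scale c (x * y)"
    and scale_mult_right: "x * scale c y = scale c (x * y)"
begin

text \<open>The copy of the field inside the algebra; \<open>c \<mapsto> scale c 1\<close> is injective because
  \<open>1 \<noteq> 0\<close> in a \<^class>\<open>ring_1\<close>.\<close>

definition scalars :: "'a set" where
  "scalars = range (\<lambda>c. scale c 1)"

definition quaternion_basis :: "'a \<Rightarrow> 'a \<Rightarrow> 'a \<Rightarrow> bool" where
  "quaternion_basis i j k \<longleftrightarrow>
     distinct [1, i, j, k] \<and> independent {1, i, j, k} \<and> span {1, i, j, k} = UNIV \<and>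
     (if CHAR('f) \<noteq> 2
      then i\<^sup>2 \<in> scalars - {0} \<and> j\<^sup>2 \<in> scalars - {0} \<and> k = i * j \<and> k = - (j * i)
      else i\<^sup>2 + i \<in> scalars \<and> j\<^sup>2 \<in> scalars - {0} \<and> k = i * j \<and> k = j * (i + 1))"

end

locale generalized_quaternion_algebra = unital_algebra scale
  for scale :: "'f::field \<Rightarrow> 'a::ring_1 \<Rightarrow> 'a" +
  assumes ex_quaternion_basis: "\<exists>i j k. quaternion_basis i j k"

section \<open>Center and additive commutator subgroup of a ring\<close>

definition ring_center :: "('a, 'b) ring_scheme \<Rightarrow> 'a set" where
  "ring_center R = {z \<in> carrier R. \<forall>x \<in> carrier R. z \<otimes>\<^bsub>R\<^esub> x = x \<otimes>\<^bsub>R\<^esub> z}"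

definition commutator_subgroup :: "('a, 'b) ring_scheme \<Rightarrow> 'a set" where
  "commutator_subgroup R = generate (add_monoid R)
     {a \<otimes>\<^bsub>R\<^esub> b \<ominus>\<^bsub>R\<^esub> b \<otimes>\<^bsub>R\<^esub> a | a b. a \<in> carrier R \<and> b \<in> carrier R}"

section \<open>Matrix rings over noncommutative rings\<close>

text \<open>The library states that \<^const>\<open>ring_mat\<close> is a ring only over commutative rings.\<close>

lemma ring_mat_noncomm: "ring (ring_mat TYPE('a :: ring_1) n b)"
proof -
  interpret S: semiring "ring_mat TYPE('a) n b" by (rule semiring_mat)
  have "\<exists>B \<in> carrier_mat n n. B + A = 0\<^sub>m n n \<and> A + B = 0\<^sub>m n n"
    if "A \<in> carrier_mat n n" for A :: "'a mat"
    using that by (intro bexI[of _ "- A"]) auto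
  then show ?thesis
    by unfold_locales
      (auto simp: ring_mat_def Units_def mult_add_distrib_mat add_mult_distrib_mat)
qed

end

theory Submission
  imports Defs "HOL-Computational_Algebra.Group_Closure"
begin

text \<open>
  Modulo commutators, a matrix is determined by its trace modulo commutators of the entry ring.
  Indeed, write \<open>E r s a\<close> for the matrix whose only nonzero entry is \<open>a\<close> at \<open>(r, s)\<close>. For
  \<open>r \<noteq> s\<close> the matrix \<open>E r s a\<close> is the commutator of \<open>E r r 1\<close> and \<open>E r s a\<close>, and
  \<open>E r r a - E s s a\<close> is the commutator of \<open>E r s a\<close> and \<open>E s r 1\<close>. So every matrix is congruent
  to \<open>E 0 0 t\<close> with \<open>t\<close> its trace, and a sum of commutators in \<open>t\<close> can be dropped because
  \<open>a \<mapsto> E 0 0 a\<close> respects sums and products.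

  The scalar matrix of a central \<open>u\<close> is central and has trace \<open>n u\<close>. Hence the matrix ring is the
  sum of its center and its commutator subgroup as soon as every element of the entry ring is,
  modulo commutators, of the form \<open>n u\<close> with \<open>u\<close> central (lemma \<open>mat_center_plus_commutators\<close>).

  In a quaternion algebra of characteristic other than \<open>2\<close> the elements \<open>i\<close>, \<open>j\<close>, \<open>k\<close> anticommute
  pairwise, and the product of any two is a nonzero scalar multiple of the third. So every
  multiple of \<open>i\<close>, \<open>j\<close> or \<open>k\<close> is a commutator and every quaternion is congruent to a scalar
  \<open>c\<close> (lemma \<open>quaternion_scalar_plus_commutators\<close>). In characteristic \<open>0\<close> the
  integer \<open>n\<close> is invertible, and \<open>u = c / n\<close> is the required central element.
\<close>

section \<open>Quaternions modulo commutators\<close>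

definition commutators :: "'a::ring set" where
  "commutators = {a * b - b * a | a b. True}"

lemma commutatorsI: "a * b - b * a \<in> commutators"
  by (auto simp: commutators_def)

context unital_algebra
begin

lemma of_nat_mult_scale_one: "of_nat m * scale c 1 = scale (of_nat m * c) 1"
  by (induction m) (simp_all add: algebra_simps scale_left_distrib)

lemma scale_one_central: "scale c 1 * x = x * scale c 1"
  by (simp add: scale_mult_left scale_mult_right)

text \<open>
  If \<open>x\<close> and \<open>y\<close> anticommute, then \<open>x y - y x = 2 x y\<close>; with \<open>2\<close> and \<open>c\<close> invertible, rescaling \<open>x\<close>
  produces every multiple of \<open>z\<close>.
\<close>

lemma anticommuting_scaled_commutator:
  assumes "y * x = - (x * y)" and "x * y = scale c z" "c \<noteq> 0" "(2::'f) \<noteq> 0"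
  shows "scale d z \<in> commutators"
proof -
  let ?e = "d / (2 * c)"
  have "scale ?e x * y - y * scale ?e x = scale ?e (scale c z + scale c z)"
    using assms by (simp add: scale_mult_left scale_mult_right scale_right_distrib)
  also have "\<dots> = scale (?e * (c + c)) z"
    by (simp only: scale_left_distrib[symmetric] scale_scale)
  also have "\<dots> = scale d z"
    using assms by (simp flip: mult_2)
  finally show ?thesis
    by (metis commutatorsI)
qed

text \<open>
  The three pairs \<open>(k, j)\<close>, \<open>(i, k)\<close>, \<open>(i, j)\<close> anticommute, with products \<open>j\<^sup>2 i\<close>, \<open>i\<^sup>2 j\<close>
  and \<open>k\<close>. Since \<open>i\<^sup>2\<close> and \<open>j\<^sup>2\<close> are nonzero scalars, all of \<open>i\<close>, \<open>j\<close>, \<open>k\<close> and their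
  multiples are commutators, so only the coordinate at \<open>1\<close> survives.
\<close>

lemma quaternion_scalar_plus_commutators:
  assumes "quaternion_basis i j k" and "CHAR('f) \<noteq> 2"
  shows "\<exists>c. x - scale c 1 \<in> group_closure commutators"
proof -
  have two: "(2::'f) \<noteq> 0"
  proof
    assume "(2::'f) = 0"
    then have "CHAR('f) dvd 2"
      by (metis of_nat_eq_0_iff_char_dvd of_nat_numeral)
    with assms(2) show False
      by (metis CHAR_not_1' One_nat_def prime_nat_iff two_is_prime_nat)
  qed
  obtain \<alpha> \<beta> where sq: "i * i = scale \<alpha> 1" "\<alpha> \<noteq> 0" "j * j = scale \<beta> 1" "\<beta> \<noteq> 0"
    and k: "k = i * j" and ji: "j * i = - (i * j)" and span: "span {1, i, j, k} = UNIV"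
    using assms by (auto simp: quaternion_basis_def scalars_def power2_eq_square)
  have ik: "i * k = scale \<alpha> j"
    by (simp add: k sq scale_mult_left flip: mult.assoc)
  have kj: "k * j = scale \<beta> i"
    by (simp add: k sq scale_mult_right mult.assoc)
  have ki: "k * i = - (i * k)"
    by (simp add: k ji mult.assoc)
  have "(j * i) * j = - (i * j * j)"
    by (simp add: ji)
  then have jk: "j * k = - (k * j)"
    by (simp add: k mult.assoc)
  have pure: "scale d i \<in> commutators" "scale d j \<in> commutators" "scale d k \<in> commutators" for d
    by (rule anticommuting_scaled_commutator[OF jk kj sq(4) two])
      (rule anticommuting_scaled_commutator[OF ki ik sq(2) two],
       rule anticommuting_scaled_commutator[OF ji, of 1], simp_all add: k two)
  have "x \<in> span {1, i, j, k}"
    using span by simp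
  then obtain c d e f where "x - scale c 1 - scale d i - scale e j - scale f k = 0"
    by (auto simp: span_breakdown_eq)
  then have "x - scale c 1 = scale d i + scale e j + scale f k"
    by (simp add: algebra_simps)
  also have "\<dots> \<in> group_closure commutators"
    by (intro group_closure_add group_closure.base insertI2 pure)
  finally show ?thesis ..
qed

end

section \<open>Commutators of matrices\<close>

text \<open>
  These facts let all later computations use the operations of the type of matrices instead of those of
  the ring structure.
\<close>

lemma commutator_subgroup_mat:
  fixes n b
  defines "C \<equiv> commutator_subgroup (ring_mat TYPE('a::ring_1) n b)"
  shows commutator_subgroup_mat_carrier: "A \<in> C \<Longrightarrow> A \<in> carrier_mat n n"
    and commutator_subgroup_mat_zero: "0\<^sub>m n n \<in> C"
    and commutator_subgroup_mat_add: "A \<in> C \<Longrightarrow> B \<in> C \<Longrightarrow> A + B \<in> C"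
    and commutator_subgroup_mat_diff: "A \<in> C \<Longrightarrow> B \<in> C \<Longrightarrow> A - B \<in> C"
    and commutator_subgroup_mat_commutator:
      "P \<in> carrier_mat n n \<Longrightarrow> Q \<in> carrier_mat n n \<Longrightarrow> P * Q - Q * P \<in> C"
proof -
  let ?M = "ring_mat TYPE('a) n b"
  interpret ring ?M by (rule ring_mat_noncomm)
  have neg: "\<ominus>\<^bsub>?M\<^esub> B = - B" if "B \<in> carrier_mat n n" for B
    using that by (intro minus_equality) (auto simp: ring_mat_simps)
  have minus: "A \<ominus>\<^bsub>?M\<^esub> B = A - B" if "A \<in> carrier_mat n n" "B \<in> carrier_mat n n" for A B
    using that by (auto simp: a_minus_def neg ring_mat_simps minus_add_uminus_mat)
  have sub: "subgroup C (add_monoid ?M)"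
    unfolding C_def commutator_subgroup_def by (rule add.generate_is_subgroup) auto
  show carr: "A \<in> carrier_mat n n" if "A \<in> C" for A
    using subgroup.mem_carrier[OF sub that] by (simp add: ring_mat_simps)
  show "0\<^sub>m n n \<in> C"
    using subgroup.one_closed[OF sub] by (simp add: ring_mat_simps)
  show add: "A + B \<in> C" if "A \<in> C" "B \<in> C" for A B
    using subgroup.m_closed[OF sub that] by (simp add: ring_mat_simps)
  show "A - B \<in> C" if "A \<in> C" "B \<in> C" for A B
    using add[OF that(1), of "- B"] subgroup.m_inv_closed[OF sub that(2)]
      minus_add_uminus_mat[OF that[THEN carr]] neg[OF carr[OF that(2)]]
    by (simp flip: a_inv_def)
  show "P * Q - Q * P \<in> C" if "P \<in> carrier_mat n n" "Q \<in> carrier_mat n n" for P Q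
  proof -
    have "P * Q - Q * P = P \<otimes>\<^bsub>?M\<^esub> Q \<ominus>\<^bsub>?M\<^esub> Q \<otimes>\<^bsub>?M\<^esub> P"
      using that by (subst minus) (auto simp: ring_mat_simps)
    then show ?thesis
      using that unfolding C_def commutator_subgroup_def
      by (intro generate.incl) (auto simp: ring_mat_simps)
  qed
qed

definition single_entry_mat :: "nat \<Rightarrow> nat \<Rightarrow> nat \<Rightarrow> 'a::zero \<Rightarrow> 'a mat" where
  "single_entry_mat n r s a = mat n n (\<lambda>(i, j). if i = r \<and> j = s then a else 0)"

lemma single_entry_mat_carrier [simp]: "single_entry_mat n r s a \<in> carrier_mat n n"
  by (simp add: single_entry_mat_def)

lemma single_entry_mat_mult:
  assumes "s < n"
  shows "single_entry_mat n r s a * single_entry_mat n t v (b::'a::ring_1) =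
    (if s = t then single_entry_mat n r v (a * b) else 0\<^sub>m n n)"
proof (rule eq_matI)
  fix i j assume "i < dim_row (if s = t then single_entry_mat n r v (a * b) else 0\<^sub>m n n)"
    and "j < dim_col (if s = t then single_entry_mat n r v (a * b) else 0\<^sub>m n n)"
  then have ij: "i < n" "j < n"
    by (auto simp: single_entry_mat_def split: if_splits)
  have "(single_entry_mat n r s a * single_entry_mat n t v b) $$ (i, j) =
    (\<Sum>l = 0..<n. (if i = r \<and> l = s then a else 0) * (if l = t \<and> j = v then b else 0))"
    using ij by (simp add: single_entry_mat_def scalar_prod_def)
  also have "\<dots> = (\<Sum>l = 0..<n. if l = s then if i = r \<and> s = t \<and> j = v then a * b else 0 else 0)"
    by (intro sum.cong) auto
  also have "\<dots> = (if i = r \<and> s = t \<and> j = v then a * b else 0)"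
    using assms by simp
  finally show "(single_entry_mat n r s a * single_entry_mat n t v b) $$ (i, j) =
    (if s = t then single_entry_mat n r v (a * b) else 0\<^sub>m n n) $$ (i, j)"
    using ij by (auto simp: single_entry_mat_def)
qed (auto simp: single_entry_mat_def)

lemma single_entry_mat_zero: "single_entry_mat n r s 0 = 0\<^sub>m n n"
  by (auto simp: single_entry_mat_def)

lemma single_entry_mat_diff:
  "single_entry_mat n r s (a - b) = single_entry_mat n r s a - single_entry_mat n r s (b::'a::ring_1)"
  by (auto simp: single_entry_mat_def)

text \<open>
  The idempotent at \<open>(r, r)\<close> fixes a matrix concentrated at \<open>(r, s)\<close> from the left and kills it from
  the right.
\<close>

lemma off_diagonal_single_entry_in_commutator_subgroup:
  assumes "r < n" "s < n" "r \<noteq> s"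
  shows "single_entry_mat n r s (a::'a::ring_1) \<in> commutator_subgroup (ring_mat TYPE('a) n b)"
proof -
  have "single_entry_mat n r r 1 * single_entry_mat n r s a
      - single_entry_mat n r s a * single_entry_mat n r r 1 = single_entry_mat n r s a"
    using assms by (auto simp: single_entry_mat_mult) (auto simp: single_entry_mat_def)
  then show ?thesis
    by (metis commutator_subgroup_mat_commutator single_entry_mat_carrier)
qed

text \<open>
  An entry travels along the diagonal: the two products of \<open>E r s a\<close> and \<open>E s r 1\<close> are \<open>E r r a\<close> and
  \<open>E s s a\<close>.
\<close>

lemma diagonal_single_entry_diff_in_commutator_subgroup:
  assumes "r < n" "s < n"
  shows "single_entry_mat n r r a - single_entry_mat n s s (a::'a::ring_1)
    \<in> commutator_subgroup (ring_mat TYPE('a) n b)"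
proof -
  have "single_entry_mat n r s a * single_entry_mat n s r 1
      - single_entry_mat n s r 1 * single_entry_mat n r s a
    = single_entry_mat n r r a - single_entry_mat n s s a"
    using assms by (simp add: single_entry_mat_mult)
  then show ?thesis
    by (metis commutator_subgroup_mat_commutator single_entry_mat_carrier)
qed

text \<open>
  The map \<open>a \<mapsto> E r r a\<close> is additive and multiplicative, so it carries commutators to commutators
  and the subgroup that they generate into the subgroup generated by commutators of matrices.
\<close>

lemma single_entry_group_closure_in_commutator_subgroup:
  assumes "r < n" and "d \<in> group_closure commutators"
  shows "single_entry_mat n r r (d::'a::ring_1) \<in> commutator_subgroup (ring_mat TYPE('a) n b)"
  using assms(2)
proof induction
  case (base d)
  show ?case
  proof (cases "d = 0")
    case True
    then show ?thesis
      by (simp add: single_entry_mat_zero commutator_subgroup_mat_zero)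
  next
    case False
    with base obtain x y where "d = x * y - y * x"
      by (auto simp: commutators_def)
    then have "single_entry_mat n r r d = single_entry_mat n r r x * single_entry_mat n r r y
        - single_entry_mat n r r y * single_entry_mat n r r x"
      using assms(1) by (simp add: single_entry_mat_mult single_entry_mat_diff)
    then show ?thesis
      by (metis commutator_subgroup_mat_commutator single_entry_mat_carrier)
  qed
next
  case (diff d e)
  then show ?case
    by (simp add: single_entry_mat_diff commutator_subgroup_mat_diff)
qed

section \<open>Decomposition of matrices\<close>

text \<open>
  Additive induction on matrices: a matrix is the sum of its entries placed in otherwise zero
  matrices. It replaces explicit sums indexed by pairs of positions.
\<close>

lemma mat_induct_single_entry [consumes 1, case_names zero add single_entry]:
  fixes W :: "'a::ring_1 mat"
  assumes W: "W \<in> carrier_mat n n"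
    and zero: "P (0\<^sub>m n n)"
    and add: "\<And>A B. A \<in> carrier_mat n n \<Longrightarrow> B \<in> carrier_mat n n \<Longrightarrow> P A \<Longrightarrow> P B \<Longrightarrow> P (A + B)"
    and single: "\<And>r s a. r < n \<Longrightarrow> s < n \<Longrightarrow> P (single_entry_mat n r s a)"
  shows "P W"
proof -
  \<comment> \<open>\<open>R S\<close> keeps the entries at the positions in \<open>S\<close>, so that induction on \<open>S\<close> adds one entry at a time.\<close>
  define R where "R S = mat n n (\<lambda>p. if p \<in> S then W $$ p else 0)" for S
  have "P (R S)" if "finite S" "S \<subseteq> {..<n} \<times> {..<n}" for S
    using that
  proof (induction S)
    case empty
    have "R {} = 0\<^sub>m n n"
      by (auto simp: R_def)
    then show ?case using zero by simp
  next
    case (insert p S)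
    obtain r s where p: "p = (r, s)" by fastforce
    have "R (insert p S) = R S + single_entry_mat n r s (W $$ p)"
      using insert.hyps by (auto simp: R_def single_entry_mat_def p)
    with insert show ?case
      by (auto simp: p R_def intro!: add single)
  qed
  from this[of "{..<n} \<times> {..<n}"] have "P (R ({..<n} \<times> {..<n}))"
    by simp
  also have "R ({..<n} \<times> {..<n}) = W"
    using W by (auto simp: R_def)
  finally show ?thesis .
qed

lemma central_smult_one_in_center:
  assumes "\<And>x. u * x = x * u"
  shows "u \<cdot>\<^sub>m 1\<^sub>m n \<in> ring_center (ring_mat TYPE('a::ring_1) n b)"
proof -
  have "(u \<cdot>\<^sub>m 1\<^sub>m n) * W = u \<cdot>\<^sub>m W" "W * (u \<cdot>\<^sub>m 1\<^sub>m n) = u \<cdot>\<^sub>m W"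
    if W: "W \<in> carrier_mat n n" for W :: "'a mat"
  proof -
    have "(\<Sum>l = 0..<n. u * (if l = i then 1 else 0) * W $$ (l, j)) = u * W $$ (i, j)"
      if "i < n" for i j
      using that by (simp add: if_distrib[of "\<lambda>z. u * z * _"] sum.delta cong: if_cong)
    then show "(u \<cdot>\<^sub>m 1\<^sub>m n) * W = u \<cdot>\<^sub>m W"
      using W by (intro eq_matI) (simp_all add: scalar_prod_def)
    have "(\<Sum>l = 0..<n. W $$ (i, l) * (u * (if l = j then 1 else 0))) = u * W $$ (i, j)"
      if "j < n" for i j
      using that assms by (simp add: if_distrib[of "\<lambda>z. _ * (z * u)"] sum.delta cong: if_cong)
    then show "W * (u \<cdot>\<^sub>m 1\<^sub>m n) = u \<cdot>\<^sub>m W"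
      using W by (intro eq_matI) (simp_all add: scalar_prod_def)
  qed
  then show ?thesis
    by (auto simp: ring_center_def ring_mat_simps)
qed

lemma ring_center_mat_add:
  assumes "A \<in> ring_center (ring_mat TYPE('a::ring_1) n b)" "B \<in> ring_center (ring_mat TYPE('a) n b)"
  shows "A + B \<in> ring_center (ring_mat TYPE('a) n b)"
  using assms by (auto simp: ring_center_def ring_mat_simps add_mult_distrib_mat[of _ n n] mult_add_distrib_mat[of _ n n])

text \<open>
  Both matrices have trace \<open>n u\<close>: the \<open>n\<close> diagonal entries \<open>u\<close> of the scalar matrix are moved
  one after the other to the top left corner.
\<close>

lemma corner_minus_scalar_mat_in_commutator_subgroup:
  assumes "0 < n"
  shows "single_entry_mat n 0 0 (of_nat n * u) - u \<cdot>\<^sub>m 1\<^sub>m n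
    \<in> commutator_subgroup (ring_mat TYPE('a::ring_1) n b)"
proof -
  \<comment> \<open>\<open>D m\<close> has \<open>u\<close> in the first \<open>m\<close> diagonal positions; it passes from \<open>0\<close> to the scalar matrix.\<close>
  define D where "D m = mat n n (\<lambda>(i, j). if i = j \<and> i < m then u else 0)" for m
  have "single_entry_mat n 0 0 (of_nat m * u) - D m
    \<in> commutator_subgroup (ring_mat TYPE('a) n b)" if "m \<le> n" for m
    using that
  proof (induction m)
    case 0
    have "single_entry_mat n 0 0 (of_nat 0 * u) - D 0 = 0\<^sub>m n n"
      by (auto simp: single_entry_mat_def D_def)
    then show ?case
      by (simp add: commutator_subgroup_mat_zero)
  next
    case (Suc m)
    have "single_entry_mat n 0 0 (of_nat (Suc m) * u) - D (Suc m) =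
      (single_entry_mat n 0 0 (of_nat m * u) - D m) + (single_entry_mat n 0 0 u - single_entry_mat n m m u)"
      by (rule eq_matI) (auto simp: single_entry_mat_def D_def algebra_simps)
    with Suc assms show ?case
      by (auto intro!: commutator_subgroup_mat_add diagonal_single_entry_diff_in_commutator_subgroup)
  qed
  moreover have "D n = u \<cdot>\<^sub>m 1\<^sub>m n"
    by (rule eq_matI) (auto simp: D_def)
  ultimately show ?thesis
    by (metis order_refl)
qed

text \<open>
  Having a decomposition is an additive property, so it suffices to decompose matrices with a single
  entry. Off the diagonal the central part is \<open>0\<close>; a diagonal entry \<open>a\<close>, congruent to \<open>n u\<close>, has
  the trace of the scalar matrix of \<open>u\<close>, up to commutators.
\<close>

lemma mat_center_plus_commutators:
  fixes n :: nat and b :: 'b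
  assumes "0 < n"
    and trace: "\<And>a::'a::ring_1. \<exists>u. (\<forall>x. u * x = x * u) \<and> a - of_nat n * u \<in> group_closure commutators"
  defines "M \<equiv> ring_mat TYPE('a) n b"
  shows "carrier M = ring_center M <+>\<^bsub>M\<^esub> commutator_subgroup M"
proof
  let ?C = "commutator_subgroup M" and ?Z = "ring_center M"
  note C = commutator_subgroup_mat[where 'a = 'a and n = n and b = b, folded M_def]
  have Zcar: "Z \<in> carrier_mat n n" if "Z \<in> ?Z" for Z
    using that by (simp add: ring_center_def M_def ring_mat_simps)
  have zero: "0\<^sub>m n n \<in> ?Z"
    by (auto simp: ring_center_def M_def ring_mat_simps)
  show "carrier M \<subseteq> ?Z <+>\<^bsub>M\<^esub> ?C"
  proof
    fix W assume "W \<in> carrier M"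
    then have "W \<in> carrier_mat n n"
      by (simp add: M_def ring_mat_simps)
    then have "\<exists>Z\<in>?Z. W - Z \<in> ?C"
    proof (induction rule: mat_induct_single_entry)
      case zero
      show ?case
        using \<open>0\<^sub>m n n \<in> ?Z\<close> C(4)[OF C(2) C(2)] by blast
    next
      case (add A B)
      then obtain Y Z where YZ: "Y \<in> ?Z" "A - Y \<in> ?C" "Z \<in> ?Z" "B - Z \<in> ?C"
        by blast
      have "(A + B) - (Y + Z) = (A - Y) + (B - Z)"
        using add.hyps YZ(1,3)[THEN Zcar] by auto
      with YZ show ?case
        by (metis C(3) M_def ring_center_mat_add)
    next
      case (single_entry r s a)
      show ?case
      proof (cases "r = s")
        case False
        then have "single_entry_mat n r s a - 0\<^sub>m n n \<in> ?C"
          unfolding M_def using single_entry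
          by (intro commutator_subgroup_mat_diff commutator_subgroup_mat_zero
              off_diagonal_single_entry_in_commutator_subgroup)
        with zero show ?thesis ..
      next
        case True
        obtain u where u: "\<And>x. u * x = x * u" "a - of_nat n * u \<in> group_closure commutators"
          using trace by blast
        let ?E = "single_entry_mat n"
        \<comment> \<open>Move \<open>a\<close> to the corner, split off its commutator part, and spread \<open>n u\<close> over the diagonal.\<close>
        have "?E r r a - u \<cdot>\<^sub>m 1\<^sub>m n =
          (?E r r a - ?E 0 0 a) + (?E 0 0 (a - of_nat n * u) + (?E 0 0 (of_nat n * u) - u \<cdot>\<^sub>m 1\<^sub>m n))"
          by (rule eq_matI) (auto simp: single_entry_mat_def)
        also have "\<dots> \<in> ?C"
          unfolding M_def using single_entry assms(1) u(2)
          by (intro commutator_subgroup_mat_add diagonal_single_entry_diff_in_commutator_subgroup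
              single_entry_group_closure_in_commutator_subgroup corner_minus_scalar_mat_in_commutator_subgroup)
        finally show ?thesis
          using True central_smult_one_in_center[of u n b, OF u(1), folded M_def] by blast
      qed
    qed
    then obtain Z where Z: "Z \<in> ?Z" "W - Z \<in> ?C" ..
    moreover have "W = Z + (W - Z)"
      using \<open>W \<in> carrier_mat n n\<close> Zcar[OF Z(1)] by auto
    ultimately show "W \<in> ?Z <+>\<^bsub>M\<^esub> ?C"
      by (auto simp: set_add_def' M_def ring_mat_simps)
  qed
  show "?Z <+>\<^bsub>M\<^esub> ?C \<subseteq> carrier M"
    using Zcar C(1) by (auto simp: set_add_def' M_def ring_mat_simps)
qed

theorem corollary2p2:
  fixes scale :: "'f::field \<Rightarrow> 'a::ring_1 \<Rightarrow> 'a"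
    and n :: nat
  assumes "generalized_quaternion_algebra scale"
    and "CHAR('f) = 0"
    and "n > 0"
  shows "let M = ring_mat TYPE('a) n () in
           carrier M = ring_center M <+>\<^bsub>M\<^esub> commutator_subgroup M"
proof -
  interpret generalized_quaternion_algebra scale by fact
  have "\<exists>u. (\<forall>x. u * x = x * u) \<and> a - of_nat n * u \<in> group_closure commutators" for a :: 'a
  proof -
    obtain c where c: "a - scale c 1 \<in> group_closure commutators"
      using ex_quaternion_basis quaternion_scalar_plus_commutators assms(2) by fastforce
    have "of_nat n \<noteq> (0::'f)"
      using assms(2,3) by (simp add: of_nat_eq_0_iff_char_dvd)
    then have "of_nat n * scale (c / of_nat n) 1 = scale c 1"
      by (simp add: of_nat_mult_scale_one)
    with c show ?thesis
      by (metis scale_one_central)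
  qed
  with assms(3) show ?thesis
    unfolding Let_def by (rule mat_center_plus_commutators)
qed

end
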